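(* Let $m,n,p$ be positive integers with $p\ge2$. The set $S(m,n,p)$ of all $m\times n\times p$ s-diagonal tensors is a closed convex cone (in the finite-dimensional real linear space $T(m,n,p)$ of $m\times n\times p$ real tensors).
   Context: Let $T(m,n,p)$ be the real linear space of $m\times n\times p$ real tensors; $\mathcal{A}(i,j,k)$ denotes the entries of $\mathcal{A}\in T(m,n,p)$ and $A^{(k)}=\mathcal{A}(:,:,k)\in\mathbb{R}^{m\times n}$ its frontal slices, $k=1,\dots,p$. A tensor is f-diagonal if all its frontal slices are (rectangular) diagonal matrices; $F(m,n,p)$ is the set of f-diagonal tensors in $T(m,n,p)$. Kilmer-Martin mapping $G:T(m,n,p)\to F(m,n,p)$. Let $\omega=e^{2\pi\sqrt{-1}/p}$. For $\mathcal{A}\in T(m,n,p)$ and $k=1,\dots,p$ put $\Delta^{(k)}(\mathcal{A})=\sum_{l=1}^p\omega^{(l-1)(k-1)}A^{(l)}\in\mathbb{C}^{m\times n}$, and let $\mathcal{D}(i,i,k)$, $i=1,\dots,\min\{m,n\}$, be the singular values of $\Delta^{(k)}(\mathcal{A})$ in nonincreasing order (counted with multiplicity). Then $\mathcal{S}=G(\mathcal{A})$ is the f-diagonal tensor with $\mathcal{S}(i,i,k)=\frac1p\sum_{l=1}^p\bar\omega^{(k-1)(l-1)}\mathcal{D}(i,i,l)$ for $i=1,\dots,\min\{m,n\}$, $k=1,\dots,p$ (these numbers are real). A tensor $\mathcal{S}\in F(m,n,p)$ is called s-diagonal if there is some $\mathcal{A}\in T(m,n,p)$ with $G(\mathcal{A})=\mathcal{S}$;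 $S(m,n,p)$ denotes the set of all s-diagonal tensors in $F(m,n,p)$. *)

theory Defs
  imports
    "HOL-Analysis.Analysis"
    "HOL-Library.Function_Algebras"
    "Jordan_Normal_Form.Schur_Decomposition"
begin

text \<open>
  Functions into a real vector space form a real vector space pointwise. The additive part is
  provided by \<^theory>\<open>HOL-Library.Function_Algebras\<close>, the topology of pointwise convergence by
  \<^theory>\<open>HOL-Analysis.Function_Topology\<close>.
\<close>

instantiation "fun" :: (type, real_vector) real_vector
begin

definition scaleR_fun :: "real \<Rightarrow> ('a \<Rightarrow> 'b) \<Rightarrow> 'a \<Rightarrow> 'b" where
  "scaleR_fun c f = (\<lambda>x. c *\<^sub>R f x)"

instance
  by standard (simp_all add: scaleR_fun_def fun_eq_iff scaleR_add_right scaleR_add_left)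

end

text \<open>
  A tensor is a function of three indices. All indices run from \<open>0\<close> (so \<open>A i j k\<close> is the entry
  at \<open>(i+1, j+1, k+1)\<close> in one-based counting), and entries out of range are \<open>0\<close>. On the
  finite-dimensional subspace \<open>tensors m n p\<close> the pointwise topology is the usual one.
\<close>

type_synonym tensor = "nat \<Rightarrow> nat \<Rightarrow> nat \<Rightarrow> real"

definition tensors :: "nat \<Rightarrow> nat \<Rightarrow> nat \<Rightarrow> tensor set" where
  "tensors m n p = {A. \<forall>i j k. \<not> (i < m \<and> j < n \<and> k < p) \<longrightarrow> A i j k = 0}"

definition fdiag_tensors :: "nat \<Rightarrow> nat \<Rightarrow> nat \<Rightarrow> tensor set" where
  "fdiag_tensors m n p = {A \<in> tensors m n p. \<forall>i j k. i \<noteq> j \<longrightarrow> A i j k = 0}"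

text \<open>
  The \<open>min m n\<close> singular values of an \<open>m \<times> n\<close> matrix \<open>M\<close>, in nonincreasing order and with
  multiplicity: square roots of the largest eigenvalues of \<open>M\<^sup>* M\<close>. The eigenvalues of this
  positive semidefinite matrix are real and nonnegative; \<open>Re\<close> only converts the type.
\<close>

definition singular_values :: "complex mat \<Rightarrow> real list" where
  "singular_values M =
     take (min (dim_row M) (dim_col M))
       (rev (sorted_list_of_multiset
         (image_mset (\<lambda>z. sqrt (Re z)) (proots (char_poly (mat_adjoint M * M))))))"

definition unity_root :: "nat \<Rightarrow> complex" where
  "unity_root p = exp (2 * of_real pi * \<i> / of_nat p)"

definition dft_slice :: "nat \<Rightarrow> nat \<Rightarrow> nat \<Rightarrow> tensor \<Rightarrow> nat \<Rightarrow> complex mat" where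
  "dft_slice m n p A k =
     mat m n (\<lambda>(i, j). \<Sum>l<p. unity_root p ^ (l * k) * of_real (A i j l))"

definition km_diag :: "nat \<Rightarrow> nat \<Rightarrow> nat \<Rightarrow> tensor \<Rightarrow> nat \<Rightarrow> nat \<Rightarrow> complex" where
  "km_diag m n p A i k =
     (\<Sum>l<p. cnj (unity_root p) ^ (k * l) * of_real (singular_values (dft_slice m n p A l) ! i))
       / of_nat p"

text \<open>The Kilmer--Martin mapping. The numbers \<open>km_diag m n p A i k\<close> are real, see below.\<close>

definition km_map :: "nat \<Rightarrow> nat \<Rightarrow> nat \<Rightarrow> tensor \<Rightarrow> tensor" where
  "km_map m n p A =
     (\<lambda>i j k. if i = j \<and> i < min m n \<and> k < p then Re (km_diag m n p A i k) else 0)"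

definition sdiag_tensors :: "nat \<Rightarrow> nat \<Rightarrow> nat \<Rightarrow> tensor set" where
  "sdiag_tensors m n p = {S \<in> fdiag_tensors m n p. \<exists>A \<in> tensors m n p. km_map m n p A = S}"

lemma length_singular_values: "length (singular_values M) = min (dim_row M) (dim_col M)"
proof -
  have "mat_adjoint M * M \<in> carrier_mat (dim_col M) (dim_col M)"
    by (auto simp: mat_adjoint_def)
  then have "degree (char_poly (mat_adjoint M * M)) = dim_col M"
    by (rule degree_monic_char_poly[THEN conjunct1])
  then have "size (proots (char_poly (mat_adjoint M * M))) = dim_col M"
    by (simp add: size_proots_complex)
  moreover have "length (sorted_list_of_multiset N) = size N" for N :: "real multiset"
    by (metis mset_sorted_list_of_multiset size_mset)
  ultimately show ?thesis
    by (simp add: singular_values_def)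
qed

lemma proots_map_poly_cnj: "proots (map_poly cnj q) = image_mset cnj (proots q)"
proof (cases "q = 0")
  case False
  interpret map_poly_inj_idom_divide_hom cnj
    by unfold_locales auto
  have "count (proots (map_poly cnj q)) x = count (image_mset cnj (proots q)) x" for x
  proof -
    have "count (proots (map_poly cnj q)) x = Polynomial.order (cnj (cnj x)) (map_poly cnj q)"
      using False by simp
    also have "\<dots> = Polynomial.order (cnj x) q"
      by (rule order_hom)
    also have "\<dots> = count (image_mset cnj (proots q)) x"
    proof -
      have "cnj -` {x} = {cnj x}"
        by force
      then show ?thesis
        using False by (cases "poly q (cnj x) = 0") (simp_all add: count_image_mset order_0I)
    qed
    finally show ?thesis .
  qed
  then show ?thesis by (rule multiset_eqI)
qed simp

lemma singular_values_cnj: "singular_values (map_mat cnj M) = singular_values M"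
proof -
  interpret cnj: comm_ring_hom cnj
    by unfold_locales auto
  have carrier: "mat_adjoint M * M \<in> carrier_mat (dim_col M) (dim_col M)"
    by (auto simp: mat_adjoint_def)
  have "mat_adjoint (map_mat cnj M) * map_mat cnj M = map_mat cnj (mat_adjoint M * M)"
    by (rule eq_matI)
      (auto simp: mat_adjoint_def scalar_prod_def mat_of_rows_def conjugate_complex_def)
  then show ?thesis
    using cnj.char_poly_hom[OF carrier]
    by (simp add: singular_values_def proots_map_poly_cnj image_mset.compositionality o_def)
qed

lemma unity_root_power:
  assumes "0 < p"
  shows "unity_root p ^ p = 1"
  using assms by (simp add: unity_root_def flip: exp_of_nat_mult)

lemma cnj_unity_root_power:
  assumes "l < p"
  shows "cnj (unity_root p) ^ (k * ((p - l) mod p)) = unity_root p ^ (k * l)"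
proof -
  have inv: "cnj (unity_root p) * unity_root p = 1"
    by (simp add: unity_root_def exp_cnj flip: exp_add)
  have "cnj (unity_root p) ^ ((p - l) mod p) = unity_root p ^ l"
  proof (cases "l = 0")
    case False
    have "cnj (unity_root p) ^ (p - l)
        = cnj (unity_root p) ^ (p - l) * (cnj (unity_root p) * unity_root p) ^ l"
      by (simp add: inv)
    also have "\<dots> = cnj (unity_root p) ^ (p - l + l) * unity_root p ^ l"
      by (simp only: power_mult_distrib power_add mult.assoc)
    also have "\<dots> = unity_root p ^ l"
      using assms unity_root_power[of p] by (simp flip: complex_cnj_power)
    finally show ?thesis using False assms by simp
  qed simp
  then show ?thesis
    by (metis mult.commute power_mult)
qed

lemma unity_root_power_reflect:
  assumes "l < p"
  shows "unity_root p ^ (k * ((p - l) mod p)) = cnj (unity_root p ^ (k * l))"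
  using cnj_unity_root_power[OF assms, of k]
  by (metis complex_cnj_cnj complex_cnj_power)

lemma dft_slice_reflect:
  assumes "k < p"
  shows "dft_slice m n p A ((p - k) mod p) = map_mat cnj (dft_slice m n p A k)"
  by (rule eq_matI) (auto simp: dft_slice_def unity_root_power_reflect[OF assms])

lemma km_diag_real: "km_diag m n p A i k \<in> \<real>"
proof -
  define D where "D l = complex_of_real (singular_values (dft_slice m n p A l) ! i)" for l
  have refl: "D ((p - l) mod p) = D l" if "l < p" for l
    using that by (simp add: D_def dft_slice_reflect singular_values_cnj)
  have bij: "bij_betw (\<lambda>l. (p - l) mod p) {..<p} {..<p}"
  proof (rule bij_betwI[where g = "\<lambda>l. (p - l) mod p"])
    have "(p - (p - l) mod p) mod p = l" if "l \<in> {..<p}" for l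
      using that by (cases "l = 0") auto
    then show "\<And>l. l \<in> {..<p} \<Longrightarrow> (p - (p - l) mod p) mod p = l"
      and "\<And>l. l \<in> {..<p} \<Longrightarrow> (p - (p - l) mod p) mod p = l"
      by blast+
  qed auto
  have "(\<Sum>l<p. cnj (unity_root p) ^ (k * l) * D l)
      = (\<Sum>l<p. cnj (unity_root p) ^ (k * ((p - l) mod p)) * D ((p - l) mod p))"
    by (rule sum.reindex_bij_betw[OF bij, symmetric])
  also have "\<dots> = (\<Sum>l<p. unity_root p ^ (k * l) * D l)"
    by (rule sum.cong) (auto simp: cnj_unity_root_power refl)
  also have "\<dots> = cnj (\<Sum>l<p. cnj (unity_root p) ^ (k * l) * D l)"
    by (simp add: D_def)
  finally have "(\<Sum>l<p. cnj (unity_root p) ^ (k * l) * D l) \<in> \<real>"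
    by (simp add: Reals_cnj_iff)
  then show ?thesis
    by (simp add: km_diag_def D_def)
qed

lemma fdiag_km_map: "km_map m n p A \<in> fdiag_tensors m n p"
  by (auto simp: km_map_def fdiag_tensors_def tensors_def)

end

theory Submission
  imports Defs
begin

text \<open>
  An f-diagonal tensor \<open>S\<close> is s-diagonal iff for every frequency the Fourier coefficients of its
  diagonal tubes are real, nonnegative and nonincreasing along the diagonal. Necessity is Fourier
  inversion; for sufficiency \<open>S\<close> is its own preimage, since its Fourier slices are then diagonal
  matrices that list their singular values. These conditions are weak inequalities between
  continuous linear functionals.
\<close>

section \<open>Singular values: sign, order, and the diagonal case\<close>

lemma mat_adjoint_carrier: "mat_adjoint M \<in> carrier_mat (dim_col M) (dim_row M)"
  by (auto simp: mat_adjoint_def)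

lemma dim_mat_adjoint [simp]:
  "dim_row (mat_adjoint M) = dim_col M" "dim_col (mat_adjoint M) = dim_row M"
  using mat_adjoint_carrier by auto

lemma index_mat_adjoint [simp]:
  assumes "i < dim_col M" and "j < dim_row M"
  shows "mat_adjoint M $$ (i, j) = conjugate (M $$ (j, i))"
  using assms by (simp add: mat_adjoint_def mat_of_rows_def)

text \<open>Pairing the eigenvector equation with \<open>v\<close> gives z times the squared norm of
  \<open>v\<close> on one side and the squared norm of \<open>M v\<close> on the other, and
  \<open>v\<close> is nonzero.\<close>

lemma eigenvalue_adjoint_mult_self_nonneg:
  fixes M :: "complex mat"
  assumes "eigenvalue (mat_adjoint M * M) z"
  shows "0 \<le> Re z"
proof -
  obtain v where v: "v \<in> carrier_vec (dim_col M)" "v \<noteq> 0\<^sub>v (dim_col M)"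
    and ev: "(mat_adjoint M * M) *\<^sub>v v = z \<cdot>\<^sub>v v"
    using assms by (auto simp: eigenvalue_def eigenvector_def)
  define a where "a = M *\<^sub>v v"
  let ?n = "dim_col M" and ?m = "dim_row M"
  have "mat_adjoint M *\<^sub>v a = z \<cdot>\<^sub>v v"
    unfolding a_def using ev assoc_mult_mat_vec[OF mat_adjoint_carrier _ v(1)] by auto
  then have entry: "z * v $ i = (\<Sum>j<?m. cnj (M $$ (j, i)) * a $ j)" if "i < ?n" for i
  proof -
    have "z * v $ i = (mat_adjoint M *\<^sub>v a) $ i"
      using \<open>mat_adjoint M *\<^sub>v a = z \<cdot>\<^sub>v v\<close> v that by simp
    then show ?thesis
      using that by (simp add: scalar_prod_def a_def conjugate_complex_def atLeast0LessThan)
  qed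
  have a: "a $ j = (\<Sum>i<?n. M $$ (j, i) * v $ i)" if "j < ?m" for j
    using that v by (simp add: a_def scalar_prod_def atLeast0LessThan)
  then have cnj_a: "cnj (a $ j) = (\<Sum>i<?n. cnj (M $$ (j, i)) * cnj (v $ i))" if "j < ?m" for j
    using that by simp
  have "z * of_real (\<Sum>i<?n. (cmod (v $ i))\<^sup>2) = (\<Sum>i<?n. cnj (v $ i) * (z * v $ i))"
    by (simp add: sum_distrib_left complex_norm_square mult_ac del: of_real_power)
  also have "\<dots> = (\<Sum>i<?n. \<Sum>j<?m. cnj (v $ i) * (cnj (M $$ (j, i)) * a $ j))"
    by (simp add: entry sum_distrib_left)
  also have "\<dots> = (\<Sum>j<?m. \<Sum>i<?n. cnj (v $ i) * (cnj (M $$ (j, i)) * a $ j))"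
    by (rule sum.swap)
  also have "\<dots> = (\<Sum>j<?m. cnj (a $ j) * a $ j)"
    by (rule sum.cong) (simp_all add: cnj_a sum_distrib_left sum_distrib_right mult_ac)
  also have "\<dots> = of_real (\<Sum>j<?m. (cmod (a $ j))\<^sup>2)"
    by (simp add: complex_norm_square mult_ac del: of_real_power)
  finally have eq: "Re z * (\<Sum>i<?n. (cmod (v $ i))\<^sup>2) = (\<Sum>j<?m. (cmod (a $ j))\<^sup>2)"
    by (auto dest: arg_cong[where f = Re] simp del: of_real_sum of_real_power)
  have "\<exists>i<?n. v $ i \<noteq> 0"
  proof (rule ccontr)
    assume "\<not> (\<exists>i<?n. v $ i \<noteq> 0)"
    then have "v = 0\<^sub>v ?n"
      using v(1) by (intro eq_vecI) auto
    with v(2) show False by simp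
  qed
  then obtain i where "i < ?n" "v $ i \<noteq> 0" by blast
  then have "0 < (\<Sum>i<?n. (cmod (v $ i))\<^sup>2)"
    by (intro sum_pos2[where i = i]) auto
  moreover have "0 \<le> Re z * (\<Sum>i<?n. (cmod (v $ i))\<^sup>2)"
    unfolding eq by (simp add: sum_nonneg)
  ultimately show ?thesis
    by (simp add: zero_le_mult_iff)
qed

text \<open>The real \<open>sqrt\<close> is an odd function in HOL, negative on negative arguments,
  so the sign must come from the eigenvalues and not from the root.\<close>

lemma singular_values_nonneg:
  assumes "x \<in> set (singular_values M)"
  shows "0 \<le> x"
proof -
  let ?N = "mat_adjoint M * M"
  have carrier: "?N \<in> carrier_mat (dim_col M) (dim_col M)"
    by auto
  have "char_poly ?N \<noteq> 0"
    using degree_monic_char_poly[OF carrier] by auto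
  moreover obtain z where "z \<in># proots (char_poly ?N)" and x: "x = sqrt (Re z)"
    using assms by (auto simp: singular_values_def dest!: in_set_takeD)
  ultimately have "eigenvalue ?N z"
    using eigenvalue_root_char_poly[OF carrier] by simp
  then show ?thesis
    using x eigenvalue_adjoint_mult_self_nonneg by simp
qed

lemma singular_values_antimono:
  assumes "i \<le> j" and "j < min (dim_row M) (dim_col M)"
  shows "singular_values M ! j \<le> singular_values M ! i"
proof -
  have "sorted_wrt (\<ge>) (singular_values M)"
    unfolding singular_values_def
    by (intro sorted_wrt_take) (simp add: sorted_wrt_rev)
  then show ?thesis
    using assms by (cases "i = j") (auto simp: sorted_wrt_iff_nth_less length_singular_values)
qed

text \<open>The characteristic polynomial splits into monic linear factors over the diagonal, and
  \<open>proots\<close> turns products of nonzero polynomials into multiset sums.\<close>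

lemma proots_char_poly_upper_triangular:
  fixes A :: "complex mat"
  assumes "A \<in> carrier_mat n n" and "upper_triangular A"
  shows "proots (char_poly A) = mset (diag_mat A)"
proof -
  have "proots (\<Prod>a\<leftarrow>xs. [:- a, 1:]) = mset xs" for xs :: "complex list"
  proof (induction xs)
    case (Cons x xs)
    have "(\<Prod>a\<leftarrow>xs. [:- a, 1:]) \<noteq> 0"
      by (auto simp: prod_list_zero_iff)
    then have "proots ([:- x, 1:] * (\<Prod>a\<leftarrow>xs. [:- a, 1:]))
        = proots [:- x, 1:] + proots (\<Prod>a\<leftarrow>xs. [:- a, 1:])"
      by (intro proots_mult) auto
    then show ?case
      using Cons.IH by (simp del: mult_pCons_left)
  qed simp
  then show ?thesis
    by (simp add: char_poly_upper_triangular[OF assms])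
qed

lemma singular_values_diagonal:
  fixes d :: "nat \<Rightarrow> real"
  assumes nonneg: "\<And>i. i < min m n \<Longrightarrow> 0 \<le> d i"
    and antimono: "\<And>i j. i \<le> j \<Longrightarrow> j < min m n \<Longrightarrow> d j \<le> d i"
  shows "singular_values (mat m n (\<lambda>(i, j). if i = j then of_real (d i) else 0))
    = map d [0..<min m n]"
proof -
  let ?M = "mat m n (\<lambda>(i, j). if i = j then complex_of_real (d i) else 0)"
  let ?N = "mat_adjoint ?M * ?M"
  \<comment> \<open>The product \<open>?N\<close> has size n, so for m < n the diagonal is padded
    with n - m zeros. By nonnegativity of \<open>d\<close> they come last in the order, where
    \<open>take\<close> cuts them off.\<close>
  let ?e = "\<lambda>i. if i < min m n then d i else 0"
  have N: "?N = mat n n (\<lambda>(i, j). if i = j then of_real ((?e i)\<^sup>2) else 0)"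
  proof (rule eq_matI)
    fix i j
    assume "i < dim_row (mat n n (\<lambda>(i, j). if i = j then complex_of_real ((?e i)\<^sup>2) else 0))"
      and "j < dim_col (mat n n (\<lambda>(i, j). if i = j then complex_of_real ((?e i)\<^sup>2) else 0))"
    then have ij: "i < n" "j < n" by auto
    have "?N $$ (i, j) = (\<Sum>k<m. cnj (?M $$ (k, i)) * ?M $$ (k, j))"
      using ij by (simp add: scalar_prod_def conjugate_complex_def atLeast0LessThan)
    \<comment> \<open>Column i of \<open>?M\<close> is supported in row i alone. For i at least m no
      such row exists and the sum is 0, in agreement with \<open>?e\<close>.\<close>
    also have "\<dots> = (\<Sum>k<m. if k = i then (if i = j then of_real ((d i)\<^sup>2) else 0) else 0)"
      using ij by (intro sum.cong) (auto simp: power2_eq_square)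
    finally show "?N $$ (i, j)
        = mat n n (\<lambda>(i, j). if i = j then complex_of_real ((?e i)\<^sup>2) else 0) $$ (i, j)"
      using ij by simp
  qed auto
  have eigenvalues: "proots (char_poly ?N) = mset (map (\<lambda>i. of_real ((?e i)\<^sup>2)) [0..<n])"
    unfolding N
    by (subst proots_char_poly_upper_triangular[where n = n])
      (auto simp: upper_triangular_def diag_mat_def intro!: image_mset_cong)
  have roots: "image_mset (\<lambda>z. sqrt (Re z)) (proots (char_poly ?N)) = mset (map ?e [0..<n])"
    unfolding eigenvalues using nonneg
    by (auto simp: multiset.map_comp o_def simp del: of_real_power intro!: image_mset_cong)
  have "sorted (rev (map ?e [0..<n]))"
    unfolding sorted_wrt_rev using nonneg antimono by (auto simp: sorted_wrt_iff_nth_less)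
  then have sort: "sort (map ?e [0..<n]) = rev (map ?e [0..<n])"
    by (intro properties_for_sort) simp_all
  have "singular_values ?M = take (min m n) (map ?e [0..<n])"
    unfolding singular_values_def roots sorted_list_of_multiset_mset sort rev_rev_ident by simp
  also have "\<dots> = map d [0..<min m n]"
    by (rule nth_equalityI) auto
  finally show ?thesis .
qed

section \<open>Fourier inversion along the diagonal tubes\<close>

lemma sum_unity_root_power:
  assumes "j < p" and "k < p"
  shows "(\<Sum>l<p. unity_root p ^ (l * k) * cnj (unity_root p) ^ (l * j))
    = (if j = k then of_nat p else 0)"
proof -
  let ?q = "unity_root p ^ k * cnj (unity_root p) ^ j"
  have inv: "unity_root p * cnj (unity_root p) = 1"
    by (simp add: unity_root_def exp_cnj flip: exp_add)
  have pow: "unity_root p ^ i = exp (2 * of_real pi * \<i> * of_nat i / of_nat p)" for i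
    by (simp add: unity_root_def mult_ac flip: exp_of_nat_mult)
  \<comment> \<open>A geometric sum: its ratio \<open>?q\<close> is a p-th root of unity, so the sum
    vanishes unless \<open>?q\<close> is 1.\<close>
  have sum: "(\<Sum>l<p. unity_root p ^ (l * k) * cnj (unity_root p) ^ (l * j)) = (\<Sum>l<p. ?q ^ l)"
    by (simp add: power_mult_distrib mult.commute[of _ k] mult.commute[of _ j] power_mult)
  show ?thesis
  proof (cases "j = k")
    case True
    then show ?thesis
      by (simp add: sum inv flip: power_mult_distrib)
  next
    case False
    have "?q \<noteq> 1"
    proof
      assume "?q = 1"
      \<comment> \<open>The factor \<open>unity_root p ^ j\<close> cancels the conjugate power in
        \<open>?q\<close>; what remains would identify two powers with distinct exponents below
        p.\<close>
      then have "unity_root p ^ j = unity_root p ^ j * ?q" by simp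
      also have "\<dots> = unity_root p ^ k * (unity_root p * cnj (unity_root p)) ^ j"
        by (simp only: power_mult_distrib mult_ac)
      finally have "unity_root p ^ j = unity_root p ^ k" by (simp add: inv)
      then show False
        using False assms complex_root_unity_eq[of p j k] by (simp add: pow)
    qed
    moreover have "?q ^ p = 1"
    proof -
      have "?q ^ p = (unity_root p ^ p) ^ k * cnj (unity_root p ^ p) ^ j"
        by (simp add: power_mult_distrib mult.commute flip: power_mult)
      then show ?thesis
        using assms by (simp add: unity_root_power)
    qed
    ultimately show ?thesis
      using False by (simp add: sum geometric_sum)
  qed
qed

text \<open>For i < min m n this is the (i, i) entry of \<open>dft_slice m n p S k\<close>. Unlike
  the singular values, it depends linearly on \<open>S\<close>.\<close>

definition tube_dft :: "nat \<Rightarrow> tensor \<Rightarrow> nat \<Rightarrow> nat \<Rightarrow> complex" where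
  "tube_dft p S i k = (\<Sum>l<p. unity_root p ^ (l * k) * of_real (S i i l))"

lemma tube_dft_km_map:
  assumes "i < min m n" and "k < p"
  shows "tube_dft p (km_map m n p A) i k = of_real (singular_values (dft_slice m n p A k) ! i)"
proof -
  define D where "D j = complex_of_real (singular_values (dft_slice m n p A j) ! i)" for j
  \<comment> \<open>The \<open>Re\<close> in \<open>km_map\<close> loses nothing, because
    \<open>km_diag_real\<close> applies; otherwise inversion would fail here.\<close>
  have "tube_dft p (km_map m n p A) i k = (\<Sum>l<p. unity_root p ^ (l * k) * km_diag m n p A i l)"
    using assms km_diag_real by (simp add: tube_dft_def km_map_def of_real_Re)
  also have "\<dots> = (\<Sum>l<p. \<Sum>j<p.
      unity_root p ^ (l * k) * cnj (unity_root p) ^ (l * j) * D j) / of_nat p"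
    by (simp add: km_diag_def D_def sum_distrib_left sum_divide_distrib mult.assoc)
  also have "\<dots> = (\<Sum>j<p. (\<Sum>l<p.
      unity_root p ^ (l * k) * cnj (unity_root p) ^ (l * j)) * D j) / of_nat p"
    by (subst sum.swap) (simp add: sum_distrib_right)
  also have "\<dots> = (\<Sum>j<p. if j = k then of_nat p * D j else 0) / of_nat p"
    by (intro arg_cong2[where f = "(/)"] sum.cong) (auto simp: sum_unity_root_power assms)
  also have "\<dots> = D k"
    using assms by simp
  finally show ?thesis by (simp add: D_def)
qed

lemma inverse_tube_dft:
  assumes "k < p"
  shows "(\<Sum>l<p. cnj (unity_root p) ^ (k * l) * tube_dft p S i l) / of_nat p = of_real (S i i k)"
proof -
  have "(\<Sum>l<p. cnj (unity_root p) ^ (k * l) * tube_dft p S i l)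
      = (\<Sum>l<p. \<Sum>j<p. unity_root p ^ (l * j) * cnj (unity_root p) ^ (l * k) * of_real (S i i j))"
    by (simp add: tube_dft_def sum_distrib_left mult_ac)
  also have "\<dots> = (\<Sum>j<p. (\<Sum>l<p.
      unity_root p ^ (l * j) * cnj (unity_root p) ^ (l * k)) * of_real (S i i j))"
    by (subst sum.swap) (simp add: sum_distrib_right)
  also have "\<dots> = (\<Sum>j<p. if j = k then of_nat p * of_real (S i i j) else 0)"
    by (intro sum.cong) (auto simp: sum_unity_root_power assms)
  finally show ?thesis
    using assms by simp
qed

section \<open>Spectral characterization of s-diagonal tensors\<close>

definition decreasing_spectrum :: "nat \<Rightarrow> nat \<Rightarrow> nat \<Rightarrow> tensor \<Rightarrow> bool" where
  "decreasing_spectrum m n p S \<longleftrightarrow>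
     (\<forall>k<p. \<forall>i<min m n. Im (tube_dft p S i k) = 0 \<and> 0 \<le> Re (tube_dft p S i k) \<and>
       (\<forall>j\<le>i. Re (tube_dft p S i k) \<le> Re (tube_dft p S j k)))"

lemma decreasing_spectrum_km_map: "decreasing_spectrum m n p (km_map m n p A)"
  by (auto simp: decreasing_spectrum_def tube_dft_km_map dft_slice_def length_singular_values
      intro!: singular_values_antimono intro: singular_values_nonneg[OF nth_mem])

text \<open>As every \<open>km_map m n p A\<close> satisfies both hypotheses, \<open>km_map\<close>
  is idempotent and the s-diagonal tensors are exactly its fixed points.\<close>

lemma km_map_fixed:
  assumes S: "S \<in> fdiag_tensors m n p" and dec: "decreasing_spectrum m n p S"
  shows "km_map m n p S = S"
proof -
  define d where "d k i = Re (tube_dft p S i k)" for k i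
  have dft: "tube_dft p S i k = of_real (d k i)" if "i < min m n" "k < p" for i k
    using dec that by (simp add: decreasing_spectrum_def d_def complex_eq_iff)
  have slice: "dft_slice m n p S k = mat m n (\<lambda>(i, j). if i = j then of_real (d k i) else 0)"
    if "k < p" for k
    using S dft[OF _ that] by (intro eq_matI) (auto simp: dft_slice_def tube_dft_def fdiag_tensors_def)
  have sv: "singular_values (dft_slice m n p S k) = map (d k) [0..<min m n]" if "k < p" for k
    unfolding slice[OF that] using dec that
    by (intro singular_values_diagonal) (auto simp: decreasing_spectrum_def d_def)
  have "km_diag m n p S i k = of_real (S i i k)" if "i < min m n" "k < p" for i k
  proof -
    have "km_diag m n p S i k = (\<Sum>l<p. cnj (unity_root p) ^ (k * l) * tube_dft p S i l) / of_nat p"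
      using that by (simp add: km_diag_def sv dft)
    then show ?thesis
      using that by (simp add: inverse_tube_dft)
  qed
  \<comment> \<open>On the diagonal, i at least min m n puts one of the two equal indices out of
    range, where tensors vanish by convention.\<close>
  moreover have "S i j k = 0" if "\<not> (i = j \<and> i < min m n \<and> k < p)" for i j k
    using S that by (cases "i = j") (auto simp: fdiag_tensors_def tensors_def)
  ultimately show ?thesis
    by (simp add: km_map_def fun_eq_iff del: min_less_iff_conj)
qed

lemma sdiag_tensors_iff:
  "S \<in> sdiag_tensors m n p \<longleftrightarrow> S \<in> fdiag_tensors m n p \<and> decreasing_spectrum m n p S"
proof
  assume "S \<in> sdiag_tensors m n p"
  then show "S \<in> fdiag_tensors m n p \<and> decreasing_spectrum m n p S"
    using decreasing_spectrum_km_map by (auto simp: sdiag_tensors_def)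
next
  assume "S \<in> fdiag_tensors m n p \<and> decreasing_spectrum m n p S"
  then show "S \<in> sdiag_tensors m n p"
    using km_map_fixed unfolding sdiag_tensors_def fdiag_tensors_def by blast
qed

section \<open>Closedness and convexity\<close>

lemma tube_dft_zero: "tube_dft p 0 i k = 0"
  by (simp add: tube_dft_def)

lemma tube_dft_add: "tube_dft p (S + T) i k = tube_dft p S i k + tube_dft p T i k"
  by (simp add: tube_dft_def sum.distrib distrib_left)

lemma tube_dft_scaleR: "tube_dft p (c *\<^sub>R S) i k = c *\<^sub>R tube_dft p S i k"
  by (simp add: tube_dft_def scaleR_fun_def scaleR_sum_right scaleR_conv_of_real sum_distrib_left
      mult_ac)

text \<open>A tensor lies in a threefold nested product space, so its coordinates are projected out
  one index at a time.\<close>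

lemma continuous_on_tensor_entry: "continuous_on UNIV (\<lambda>S::tensor. S i j k)"
proof -
  have "continuous_on UNIV (\<lambda>S::tensor. S i)"
    by (rule continuous_on_product_coordinates)
  then have "continuous_on UNIV (\<lambda>S::tensor. S i j)"
    by (rule continuous_on_product_then_coordinatewise)
  then show ?thesis
    by (rule continuous_on_product_then_coordinatewise)
qed

lemma continuous_on_tube_dft: "continuous_on UNIV (\<lambda>S. tube_dft p S i k)"
  unfolding tube_dft_def by (intro continuous_intros continuous_on_tensor_entry)

lemma closed_fdiag_tensors: "closed (fdiag_tensors m n p)"
  unfolding fdiag_tensors_def tensors_def mem_Collect_eq
  \<comment> \<open>An implication defines a closed set if its premise is open; the index conditions
    do not mention the tensor, so they are open trivially.\<close>
  by (intro closed_Collect_conj closed_Collect_all closed_Collect_imp closed_Collect_eq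
      open_Collect_const continuous_on_tensor_entry continuous_on_const)

lemma closed_decreasing_spectrum: "closed {S. decreasing_spectrum m n p S}"
  unfolding decreasing_spectrum_def
  by (intro closed_Collect_conj closed_Collect_all closed_Collect_imp closed_Collect_eq
      closed_Collect_le open_Collect_const continuous_on_const continuous_on_Re continuous_on_Im
      continuous_on_tube_dft)

lemma closed_sdiag_tensors: "closed (sdiag_tensors m n p)"
proof -
  have "sdiag_tensors m n p = fdiag_tensors m n p \<inter> {S. decreasing_spectrum m n p S}"
    by (auto simp: sdiag_tensors_iff)
  then show ?thesis
    by (simp add: closed_Int closed_fdiag_tensors closed_decreasing_spectrum)
qed

lemma convex_cone_fdiag_tensors: "convex_cone (fdiag_tensors m n p)"
  by (auto simp: convex_cone_iff fdiag_tensors_def tensors_def scaleR_fun_def)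

text \<open>\<open>Re\<close> and \<open>Im\<close> of \<open>tube_dft\<close> are real-linear in
  the tensor, and homogeneous linear equations and weak inequalities survive sums and nonnegative
  scaling.\<close>

lemma convex_cone_decreasing_spectrum: "convex_cone {S. decreasing_spectrum m n p S}"
  by (auto simp: convex_cone_iff decreasing_spectrum_def tube_dft_zero tube_dft_add tube_dft_scaleR
      intro!: add_mono mult_left_mono)

theorem mainTheorem6:
  fixes m n p :: nat
  assumes "0 < m" and "0 < n" and "2 \<le> p"
  shows "closedin (top_of_set (tensors m n p)) (sdiag_tensors m n p)
    \<and> convex_cone (sdiag_tensors m n p)"
proof
  have "sdiag_tensors m n p \<subseteq> tensors m n p"
    by (auto simp: sdiag_tensors_def fdiag_tensors_def)
  \<comment> \<open>Closedness in the whole function space restricts to the subspace of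
    tensors.\<close>
  then show "closedin (top_of_set (tensors m n p)) (sdiag_tensors m n p)"
    using closed_sdiag_tensors by (simp add: closed_subset)
  show "convex_cone (sdiag_tensors m n p)"
    using convex_cone_fdiag_tensors[of m n p] convex_cone_decreasing_spectrum[of m n p]
    by (simp add: convex_cone_iff sdiag_tensors_iff)
qed

end
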